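(* Let $b,d,e,y,u,w,q,t_1,t_2$ be nonzero complex numbers, let $r_1,r_2,s_1,s_2,s_3$ be nonnegative real numbers, and let $n\ge0$ be an integer. Put $C_0(t_1)=(1-bt_1)(1-dt_1)/t_1$. Assume that no denominator below vanishes. Then $$C_0(t_1)\sum_{k=0}^{n-1}\mathcal D\bigl(et_1q^{2(r_2-r_1)(k-1)},bdet_1q^{2(r_1+r_2)(k-1)+2}\bigr)q^{2r_1(k-1)+1}\,\frac{(bq,dq;q^{2r_1})_{k-1}(eq,bdet_1^2q;q^{2r_2})_{k-1}}{(det_1q,bet_1q;q^{2r_2})_k(bdt_1q,q/t_1;q^{2r_1})_k}$$ $$\times\frac{(yq;q^{2s_1})_k(wq,uq;q^{2s_2})_k(ywut_2^2q;q^{2s_3})_k}{(wut_2q;q^{2s_2+s_3-s_1})_k(yut_2q,ywt_2q;q^{s_1+s_3})_k(q/t_2;q^{s_1+2s_2-s_3})_k}$$ $$=\frac{(bq,dq;q^{2r_1})_{n-1}(eq,bdet_1^2q;q^{2r_2})_{n-1}}{(det_1q,bet_1q;q^{2r_2})_{n-1}(bdt_1q,q/t_1;q^{2r_1})_{n-1}}\,\frac{(yq;q^{2s_1})_n(wq,uq;q^{2s_2})_n(ywut_2^2q;q^{2s_3})_n}{(wut_2q;q^{2s_2+s_3-s_1})_n(yut_2q,ywt_2q;q^{s_1+s_3})_n(q/t_2;q^{s_1+2s_2-s_3})_n}$$ $$-\frac{(q^{2r_2}-det_1q)(q^{2r_2}-bet_1q)(q^{2r_1}-bdt_1q)(q^{2r_1}-q/t_1)}{(q^{2r_1}-bq)(q^{2r_1}-dq)(q^{2r_2}-eq)(q^{2r_2}-bdet_1^2q)}$$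 $$-\frac1{t_2}\sum_{k=0}^{n-1}\mathcal D\bigl(yt_2q^{(s_1+s_3-2s_2)k},ut_2q^{(s_3-s_1)k},wt_2q^{(s_3-s_1)k},ywut_2q^{(s_1+2s_2+s_3)k+2}\bigr)q^{(s_1+2s_2-s_3)k+1}$$ $$\times\frac{(yq;q^{2s_1})_k(wq,uq;q^{2s_2})_k(ywut_2^2q;q^{2s_3})_k}{(wut_2q;q^{2s_2+s_3-s_1})_{k+1}(yut_2q,ywt_2q;q^{s_1+s_3})_{k+1}(q/t_2;q^{s_1+2s_2-s_3})_{k+1}}\,\frac{(bq,dq;q^{2r_1})_k(eq,bdet_1^2q;q^{2r_2})_k}{(det_1q,bet_1q;q^{2r_2})_k(bdt_1q,q/t_1;q^{2r_1})_k}.$$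
   Context: $\mathcal D(x_1,\dots,x_m):=\prod_{i=1}^m(1-x_i)$. For a nonzero base $q$ and an integer $m\ge 0$, $(a;q)_m=\prod_{j=0}^{m-1}(1-aq^j)$, $(a;q)_{-1}=1/(1-a/q)$, and $(a_1,\dots,a_l;q)_m=\prod_{i=1}^l(a_i;q)_m$. Real powers are $q^t=\exp(t\log q)$ for a fixed choice of $\log q$. Empty sums are $0$. (The paper calls this a $(2,3)$-type transformation with degree $2m$, $m=\max\{r_1,r_2,s_1,s_2,s_3\}$.) *)

theory Defs
  imports Complex_Main
begin

(* The real power q^t, where L is the chosen value of log q. *)
definition qpow :: "complex \<Rightarrow> real \<Rightarrow> complex" where
  "qpow L t = exp (complex_of_real t * L)"

(* The q-shifted factorial (a;q)_m for m \<ge> -1; indices below -1 are not used and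
   get an irrelevant value.  If 1 - a/q = 0 then (a;q)_{-1} is mathematically undefined
   and qpoch a q (-1) = 0, so the condition qpoch a q (-1) \<noteq> 0 also says that
   (a;q)_{-1} is defined. *)
definition qpoch :: "complex \<Rightarrow> complex \<Rightarrow> int \<Rightarrow> complex" where
  "qpoch a q m = (if m = - 1 then 1 / (1 - a / q) else (\<Prod>j<nat m. 1 - a * q ^ j))"

definition qpochs :: "complex list \<Rightarrow> complex \<Rightarrow> int \<Rightarrow> complex" where
  "qpochs as q m = (\<Prod>a\<leftarrow>as. qpoch a q m)"

definition calD :: "complex list \<Rightarrow> complex" where
  "calD xs = (\<Prod>x\<leftarrow>xs. 1 - x)"

definition C0 :: "complex \<Rightarrow> complex \<Rightarrow> complex \<Rightarrow> complex" where
  "C0 b d t = (1 - b * t) * (1 - d * t) / t"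

end

theory Submission
  imports Defs
begin

text \<open>
  Write \<open>A\<^sub>k\<close> and \<open>B\<^sub>k\<close> for the two quotients of shifted factorials of index \<open>k\<close>. The
  transformation is summation by parts for \<open>\<Sum>k<n. (A\<^sub>k - A\<^sub>k\<^sub>-\<^sub>1) * B\<^sub>k\<close>. Both differences
  \<open>A\<^sub>k - A\<^sub>k\<^sub>-\<^sub>1\<close> and \<open>B\<^sub>k\<^sub>+\<^sub>1 - B\<^sub>k\<close> factor by the same polynomial identity
  \<open>(1 - Y)(1 - W)(1 - U)(1 - YWUT\<^sup>2) - (1 - WUT)(1 - YUT)(1 - YWT)(1 - 1/T)
   = (1 - YT)(1 - UT)(1 - WT)(1 - YWUT)/T\<close>.
\<close>

lemma product_difference_factorization:
  fixes Y W U T :: "'a::field"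
  assumes "T \<noteq> 0"
  shows "(1 - Y) * (1 - W) * (1 - U) * (1 - Y*W*U*T^2)
           - (1 - W*U*T) * (1 - Y*U*T) * (1 - Y*W*T) * (1 - 1/T)
         = (1 - Y*T) * (1 - U*T) * (1 - W*T) * (1 - Y*W*U*T) / T"
proof -
  \<comment> \<open>Naming the inverse makes the claim a polynomial identity modulo
    \<open>R * T = 1\<close>, which \<open>algebra\<close> decides.\<close>
  obtain R where R: "R * T = 1" "1 / T = R"
    using assms by (metis nonzero_divide_eq_eq)
  have "(1 - Y) * (1 - W) * (1 - U) * (1 - Y*W*U*T^2)
          - (1 - W*U*T) * (1 - Y*U*T) * (1 - Y*W*T) * (1 - R)
        = R * ((1 - Y*T) * (1 - U*T) * (1 - W*T) * (1 - Y*W*U*T))"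
    using R(1) by algebra
  then show ?thesis
    using R(2) by (metis mult.commute mult_1 times_divide_eq_right)
qed

text \<open>The shift sits on \<open>f\<close> because, with \<open>f = A\<close> and
  \<open>g = B\<close>, the term \<open>A (Suc k)\<close> is the first quotient at index
  \<open>k\<close>, as in the sum on the right of the theorem.\<close>

lemma sum_by_parts:
  fixes f g :: "nat \<Rightarrow> 'a::comm_ring"
  shows "(\<Sum>k<n. (f (Suc k) - f k) * g k)
         = f n * g n - f 0 * g 0 - (\<Sum>k<n. f (Suc k) * (g (Suc k) - g k))"
  by (induction n) (simp_all add: algebra_simps)

lemma qpow_add: "qpow L (s + t) = qpow L s * qpow L t"
  by (simp add: qpow_def ring_distribs exp_add)

lemma qpow_diff: "qpow L (s - t) = qpow L s / qpow L t"
  by (simp add: qpow_def ring_distribs exp_diff)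

lemma qpow_power: "qpow L s ^ k = qpow L (s * real k)"
  by (simp add: qpow_def exp_of_nat_mult[symmetric] algebra_simps)

lemma qpow_double: "qpow L (2 * s) = qpow L s ^ 2"
  by (simp add: qpow_power mult.commute)

lemma qpow_nonzero [simp]: "qpow L s \<noteq> 0"
  by (simp add: qpow_def)

lemma qpow_one: "qpow L 1 = exp L"
  by (simp add: qpow_def)

lemma qpow_zero [simp]: "qpow L 0 = 1"
  by (simp add: qpow_def)

lemma one_minus_divide:
  fixes a p :: "'a::field"
  shows "p \<noteq> 0 \<Longrightarrow> 1 - a / p = (p - a) / p"
  by (simp add: diff_divide_distrib)

lemma qpoch_zero [simp]: "qpoch a p 0 = 1"
  by (simp add: qpoch_def)

text \<open>Clearing the inner fraction produces the factors of the boundary term. If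
  \<open>a = qpow L s\<close>, both sides are 0 because division by zero gives 0.\<close>

lemma qpoch_minus_one: "qpoch a (qpow L s) (- 1) = qpow L s / (qpow L s - a)"
  by (simp add: qpoch_def one_minus_divide)

lemma qpoch_Suc:
  "qpoch a (qpow L s) (int k + 1) = qpoch a (qpow L s) (int k) * (1 - a * qpow L (s * real k))"
  by (simp add: qpoch_def nat_add_distrib qpow_power)

text \<open>Only \<open>k = 0\<close> is special: the last factor is then
  \<open>1 - a / qpow L s\<close>, the reciprocal of the value at index \<open>-1\<close>, and the
  hypothesis keeps it nonzero so that the product is 1.\<close>

lemma qpoch_step:
  assumes "a \<noteq> qpow L s"
  shows "qpoch a (qpow L s) (int k)
         = qpoch a (qpow L s) (int k - 1) * (1 - a * qpow L (s * (real k - 1)))"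
proof (cases k)
  case 0
  have "qpow L (- s) = 1 / qpow L s"
    using qpow_diff[of L 0 s] by simp
  then show ?thesis
    using 0 assms by (simp add: qpoch_def)
next
  case (Suc m)
  then show ?thesis
    using qpoch_Suc[of a L s m] by (simp add: add.commute)
qed

theorem corollary4p8:
  fixes b d e y u w q L t1 t2 :: complex
    and r1 r2 s1 s2 s3 :: real
    and n :: nat
  assumes nonzero: "b \<noteq> 0" "d \<noteq> 0" "e \<noteq> 0" "y \<noteq> 0" "u \<noteq> 0" "w \<noteq> 0" "q \<noteq> 0" "t1 \<noteq> 0" "t2 \<noteq> 0"
    and log_q: "exp L = q"
    and nonneg: "r1 \<ge> 0" "r2 \<ge> 0" "s1 \<ge> 0" "s2 \<ge> 0" "s3 \<ge> 0"
    and den_lhs: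
      "\<forall>k<n. qpochs [d*e*t1*q, b*e*t1*q] (qpow L (2*r2)) (int k)
             * qpochs [b*d*t1*q, q/t1] (qpow L (2*r1)) (int k) \<noteq> 0"
      "\<forall>k<n. qpochs [w*u*t2*q] (qpow L (2*s2+s3-s1)) (int k)
             * qpochs [y*u*t2*q, y*w*t2*q] (qpow L (s1+s3)) (int k)
             * qpochs [q/t2] (qpow L (s1+2*s2-s3)) (int k) \<noteq> 0"
    and den_boundary:
      "qpochs [d*e*t1*q, b*e*t1*q] (qpow L (2*r2)) (int n - 1)
       * qpochs [b*d*t1*q, q/t1] (qpow L (2*r1)) (int n - 1) \<noteq> 0"
      "qpochs [w*u*t2*q] (qpow L (2*s2+s3-s1)) (int n)
       * qpochs [y*u*t2*q, y*w*t2*q] (qpow L (s1+s3)) (int n)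
       * qpochs [q/t2] (qpow L (s1+2*s2-s3)) (int n) \<noteq> 0"
      "(qpow L (2*r1) - b*q) * (qpow L (2*r1) - d*q)
       * (qpow L (2*r2) - e*q) * (qpow L (2*r2) - b*d*e*t1^2*q) \<noteq> 0"
    and den_rhs:
      "\<forall>k<n. qpochs [w*u*t2*q] (qpow L (2*s2+s3-s1)) (int k + 1)
             * qpochs [y*u*t2*q, y*w*t2*q] (qpow L (s1+s3)) (int k + 1)
             * qpochs [q/t2] (qpow L (s1+2*s2-s3)) (int k + 1) \<noteq> 0"
      "\<forall>k<n. qpochs [d*e*t1*q, b*e*t1*q] (qpow L (2*r2)) (int k)
             * qpochs [b*d*t1*q, q/t1] (qpow L (2*r1)) (int k) \<noteq> 0"
  shows
    "C0 b d t1 *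
     (\<Sum>k<n. calD [e*t1 * qpow L (2*(r2-r1)*(real k - 1)),
                   b*d*e*t1 * qpow L (2*(r1+r2)*(real k - 1) + 2)]
            * qpow L (2*r1*(real k - 1) + 1)
            * ((qpochs [b*q, d*q] (qpow L (2*r1)) (int k - 1)
                * qpochs [e*q, b*d*e*t1^2*q] (qpow L (2*r2)) (int k - 1))
               / (qpochs [d*e*t1*q, b*e*t1*q] (qpow L (2*r2)) (int k)
                  * qpochs [b*d*t1*q, q/t1] (qpow L (2*r1)) (int k)))
            * ((qpochs [y*q] (qpow L (2*s1)) (int k)
                * qpochs [w*q, u*q] (qpow L (2*s2)) (int k)
                * qpochs [y*w*u*t2^2*q] (qpow L (2*s3)) (int k))
               / (qpochs [w*u*t2*q] (qpow L (2*s2+s3-s1)) (int k)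
                  * qpochs [y*u*t2*q, y*w*t2*q] (qpow L (s1+s3)) (int k)
                  * qpochs [q/t2] (qpow L (s1+2*s2-s3)) (int k))))
     = ((qpochs [b*q, d*q] (qpow L (2*r1)) (int n - 1)
         * qpochs [e*q, b*d*e*t1^2*q] (qpow L (2*r2)) (int n - 1))
        / (qpochs [d*e*t1*q, b*e*t1*q] (qpow L (2*r2)) (int n - 1)
           * qpochs [b*d*t1*q, q/t1] (qpow L (2*r1)) (int n - 1)))
       * ((qpochs [y*q] (qpow L (2*s1)) (int n)
           * qpochs [w*q, u*q] (qpow L (2*s2)) (int n)
           * qpochs [y*w*u*t2^2*q] (qpow L (2*s3)) (int n))
          / (qpochs [w*u*t2*q] (qpow L (2*s2+s3-s1)) (int n)
             * qpochs [y*u*t2*q, y*w*t2*q] (qpow L (s1+s3)) (int n)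
             * qpochs [q/t2] (qpow L (s1+2*s2-s3)) (int n)))
       - ((qpow L (2*r2) - d*e*t1*q) * (qpow L (2*r2) - b*e*t1*q)
          * (qpow L (2*r1) - b*d*t1*q) * (qpow L (2*r1) - q/t1))
         / ((qpow L (2*r1) - b*q) * (qpow L (2*r1) - d*q)
            * (qpow L (2*r2) - e*q) * (qpow L (2*r2) - b*d*e*t1^2*q))
       - 1/t2 *
         (\<Sum>k<n. calD [y*t2 * qpow L ((s1+s3-2*s2) * real k),
                       u*t2 * qpow L ((s3-s1) * real k),
                       w*t2 * qpow L ((s3-s1) * real k),
                       y*w*u*t2 * qpow L ((s1+2*s2+s3) * real k + 2)]
                * qpow L ((s1+2*s2-s3) * real k + 1)
                * ((qpochs [y*q] (qpow L (2*s1)) (int k)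
                    * qpochs [w*q, u*q] (qpow L (2*s2)) (int k)
                    * qpochs [y*w*u*t2^2*q] (qpow L (2*s3)) (int k))
                   / (qpochs [w*u*t2*q] (qpow L (2*s2+s3-s1)) (int k + 1)
                      * qpochs [y*u*t2*q, y*w*t2*q] (qpow L (s1+s3)) (int k + 1)
                      * qpochs [q/t2] (qpow L (s1+2*s2-s3)) (int k + 1)))
                * ((qpochs [b*q, d*q] (qpow L (2*r1)) (int k)
                    * qpochs [e*q, b*d*e*t1^2*q] (qpow L (2*r2)) (int k))
                   / (qpochs [d*e*t1*q, b*e*t1*q] (qpow L (2*r2)) (int k)
                      * qpochs [b*d*t1*q, q/t1] (qpow L (2*r1)) (int k))))"
proof -
  define num1 where "num1 m = qpochs [b*q, d*q] (qpow L (2*r1)) m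
      * qpochs [e*q, b*d*e*t1^2*q] (qpow L (2*r2)) m" for m
  define den1 where "den1 m = qpochs [d*e*t1*q, b*e*t1*q] (qpow L (2*r2)) m
      * qpochs [b*d*t1*q, q/t1] (qpow L (2*r1)) m" for m
  define num2 where "num2 m = qpochs [y*q] (qpow L (2*s1)) m
      * qpochs [w*q, u*q] (qpow L (2*s2)) m * qpochs [y*w*u*t2^2*q] (qpow L (2*s3)) m" for m
  define den2 where "den2 m = qpochs [w*u*t2*q] (qpow L (2*s2+s3-s1)) m
      * qpochs [y*u*t2*q, y*w*t2*q] (qpow L (s1+s3)) m
      * qpochs [q/t2] (qpow L (s1+2*s2-s3)) m" for m
  define bd where "bd = ((qpow L (2*r2) - d*e*t1*q) * (qpow L (2*r2) - b*e*t1*q)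
          * (qpow L (2*r1) - b*d*t1*q) * (qpow L (2*r1) - q/t1))
         / ((qpow L (2*r1) - b*q) * (qpow L (2*r1) - d*q)
            * (qpow L (2*r2) - e*q) * (qpow L (2*r2) - b*d*e*t1^2*q))"
  \<comment> \<open>\<open>A k\<close> is the first quotient at index \<open>k - 1\<close>. Its value at index \<open>-1\<close> is given by \<open>bd\<close>, since
      \<open>num1 (-1) / den1 (-1)\<close> is a junk value when a factor of \<open>bd\<close> vanishes.\<close>
  define A where "A k = (if k = 0 then bd else num1 (int k - 1) / den1 (int k - 1))" for k
  define B where "B k = num2 (int k) / den2 (int k)" for k
  define dA where "dA k = calD [e*t1 * qpow L (2*(r2-r1)*(real k - 1)),
                   b*d*e*t1 * qpow L (2*(r1+r2)*(real k - 1) + 2)]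
            * qpow L (2*r1*(real k - 1) + 1)" for k
  define dB where "dB k = calD [y*t2 * qpow L ((s1+s3-2*s2) * real k),
                       u*t2 * qpow L ((s3-s1) * real k),
                       w*t2 * qpow L ((s3-s1) * real k),
                       y*w*u*t2 * qpow L ((s1+2*s2+s3) * real k + 2)]
                * qpow L ((s1+2*s2-s3) * real k + 1)" for k

  have bd_ne: "b*q \<noteq> qpow L (2*r1)" "d*q \<noteq> qpow L (2*r1)" "e*q \<noteq> qpow L (2*r2)"
      "b*d*e*t1^2*q \<noteq> qpow L (2*r2)"
    using den_boundary(3) by auto
  have den1_ne: "den1 (int k) \<noteq> 0" if "k < n" for k
    using den_lhs(1) that by (simp add: den1_def)
  have den2_ne: "den2 (int k) \<noteq> 0" if "k \<le> n" for k
    using den_lhs(2) den_boundary(2) that by (cases "k = n") (auto simp: den2_def)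

  have q1: "qpow L 1 = q" using log_q by (simp add: qpow_one)
  have q2: "qpow L 2 = q^2" using qpow_double[of L 1] q1 by simp

  have step1: "A (Suc k) - A k = C0 b d t1 * dA k * (num1 (int k - 1) / den1 (int k))" if k: "k < n" for k
  proof -
    \<comment> \<open>With \<open>x\<close> and \<open>z\<close> every real power of
      \<open>q\<close> in this step becomes a Laurent monomial in \<open>x\<close>,
      \<open>z\<close>, \<open>q\<close>.\<close>
    define x where "x = qpow L (r1 * (real k - 1))"
    define z where "z = qpow L (r2 * (real k - 1))"
    have xz: "x \<noteq> 0" "z \<noteq> 0" by (simp_all add: x_def z_def)
    have p1: "qpow L (2*r1*(real k - 1)) = x^2" and p2: "qpow L (2*r2*(real k - 1)) = z^2"
      by (simp_all add: x_def z_def qpow_double mult.assoc)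
    \<comment> \<open>\<open>N\<close> and \<open>M\<close> are the factors that \<open>num1\<close>
      and \<open>den1\<close> gain from index \<open>k - 1\<close> to \<open>k\<close>. Over the
      common quotient \<open>num1 (int k - 1) / den1 (int k)\<close>, the difference of the
      \<open>A\<close> values is \<open>N - M\<close>.\<close>
    define N where "N = (1 - b*q*x^2) * (1 - d*q*x^2) * (1 - e*q*z^2) * (1 - b*d*e*t1^2*q*z^2)"
    define M where "M = (1 - d*e*t1*q*z^2) * (1 - b*e*t1*q*z^2) * (1 - b*d*t1*q*x^2) * (1 - q/t1*x^2)"
    have num_step: "num1 (int k) = num1 (int k - 1) * N"
      unfolding num1_def N_def qpochs_def
      using bd_ne by (simp add: qpoch_step[of _ L _ k] p1 p2)
    have A_Suc: "A (Suc k) = num1 (int k - 1) / den1 (int k) * N"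
      by (simp add: A_def num_step)
    have A_k: "A k = num1 (int k - 1) / den1 (int k) * M"
    proof (cases k)
      case 0
      \<comment> \<open>At \<open>k = 0\<close>, \<open>x^2\<close> and \<open>z^2\<close> are the
        reciprocals of the two bases. Clearing them from \<open>M\<close> leaves the numerator of
        \<open>bd\<close> over base powers that cancel against those in
        \<open>num1 (-1)\<close>.\<close>
      have inv: "x^2 = 1 / qpow L (2*r1)" "z^2 = 1 / qpow L (2*r2)"
        using p1 p2 0 qpow_diff[of L 0 "2*r1"] qpow_diff[of L 0 "2*r2"] by simp_all
      have M: "M = ((qpow L (2*r2) - d*e*t1*q) * (qpow L (2*r2) - b*e*t1*q)
          * (qpow L (2*r1) - b*d*t1*q) * (qpow L (2*r1) - q/t1))
          / (qpow L (2*r1) ^ 2 * qpow L (2*r2) ^ 2)"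
        unfolding M_def inv times_divide_eq_right mult_1_right one_minus_divide[OF qpow_nonzero]
        by (simp only: divide_divide_eq_left times_divide_eq_left times_divide_eq_right power2_eq_square mult_ac)
      have num: "num1 (-1) = (qpow L (2*r1) ^ 2 * qpow L (2*r2) ^ 2) /
            ((qpow L (2*r1) - b*q) * (qpow L (2*r1) - d*q)
            * (qpow L (2*r2) - e*q) * (qpow L (2*r2) - b*d*e*t1^2*q))"
        unfolding num1_def qpochs_def
        by (simp add: qpoch_minus_one power2_eq_square)
      have "den1 0 = 1" by (simp add: den1_def qpochs_def)
      then show ?thesis using 0 by (simp add: A_def bd_def M num)
    next
      case (Suc m)
      have "den1 (int k) = den1 (int k - 1) * M"
        unfolding den1_def M_def qpochs_def using Suc p1 p2
        by (simp add: qpoch_Suc add.commute[of 1 "int _"])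
      then show ?thesis using den1_ne[OF k] Suc by (simp add: A_def)
    qed
    \<comment> \<open>\<open>T\<close> is chosen so that \<open>1 / T\<close> is the term
      \<open>q/t1*x^2\<close> of \<open>M\<close>. Then \<open>U*T = d*t1\<close> and
      \<open>W*T = b*t1\<close> do not depend on \<open>k\<close>, which is why
      \<open>C0 b d t1\<close> comes out of the sum.\<close>
    define T where "T = t1 / (q * x^2)"
    have T: "T \<noteq> 0" using nonzero xz by (simp add: T_def)
    have Q: "qpow L (2*(r2-r1)*(real k - 1)) = z^2 / x^2"
        "qpow L (2*(r1+r2)*(real k - 1) + 2) = x^2 * z^2 * q^2"
        "qpow L (2*r1*(real k - 1) + 1) = x^2 * q"
      by (simp_all add: qpow_add qpow_diff ring_distribs q1 q2 p1[symmetric] p2[symmetric])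
    have "N - M = C0 b d t1 * dA k"
      using product_difference_factorization[OF T, of "e*q*z^2" "b*q*x^2" "d*q*x^2"]
      unfolding N_def M_def dA_def Q calD_def C0_def T_def
      using nonzero xz by (simp add: field_simps power2_eq_square)
    then show ?thesis
      unfolding A_Suc A_k by (metis mult.commute right_diff_distrib)
  qed

  have step2: "B (Suc k) - B k = 1/t2 * dB k * (num2 (int k) / den2 (int k + 1))" if k: "k < n" for k
  proof -
    define a where "a = qpow L (s1 * real k)"
    define c where "c = qpow L (s2 * real k)"
    define g where "g = qpow L (s3 * real k)"
    have ne: "a \<noteq> 0" "c \<noteq> 0" "g \<noteq> 0" by (simp_all add: a_def c_def g_def)
    have p: "qpow L (2*s1*real k) = a^2" "qpow L (2*s2*real k) = c^2" "qpow L (2*s3*real k) = g^2"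
      by (simp_all add: a_def c_def g_def qpow_double mult.assoc)
    have Q: "qpow L ((2*s2+s3-s1)*real k) = c^2*g/a" "qpow L ((s1+s3)*real k) = a*g"
       "qpow L ((s1+2*s2-s3)*real k) = a*c^2/g"
       "qpow L ((s1+s3-2*s2) * real k) = a*g/c^2" "qpow L ((s3-s1) * real k) = g/a"
       "qpow L ((s1+2*s2+s3) * real k + 2) = a*c^2*g*q^2"
       "qpow L ((s1+2*s2-s3) * real k + 1) = a*c^2/g*q"
      by (simp_all add: qpow_add qpow_diff ring_distribs q1 q2 p a_def[symmetric] g_def[symmetric])
    define N where "N = (1 - y*q*a^2) * (1 - w*q*c^2) * (1 - u*q*c^2) * (1 - y*w*u*t2^2*q*g^2)"
    define M where "M = (1 - w*u*t2*q*(c^2*g/a)) * (1 - y*u*t2*q*(a*g)) * (1 - y*w*t2*q*(a*g))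
        * (1 - q/t2*(a*c^2/g))"
    have num_step: "num2 (int k + 1) = num2 (int k) * N"
      unfolding num2_def N_def qpochs_def by (simp add: qpoch_Suc p)
    have den_step: "den2 (int k + 1) = den2 (int k) * M"
      unfolding den2_def M_def qpochs_def by (simp add: qpoch_Suc Q)
    \<comment> \<open>This makes \<open>M\<close> nonzero, so it can be cancelled to put
      \<open>B k\<close> over the denominator of \<open>B (Suc k)\<close>.\<close>
    have "den2 (int k + 1) \<noteq> 0" using den2_ne[of "Suc k"] k by (simp add: add.commute)
    then have B_k: "B k = num2 (int k) / den2 (int k + 1) * M"
      by (simp add: B_def den_step)
    have B_Suc: "B (Suc k) = num2 (int k) / den2 (int k + 1) * N"
      by (simp add: B_def num_step add.commute[of 1 "int _"])
    \<comment> \<open>Again \<open>1 / T\<close> is the last term of \<open>M\<close>, here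
      \<open>q/t2*(a*c^2/g)\<close>. Now \<open>U*T\<close> and \<open>W*T\<close> carry the factor
      \<open>g/a\<close>, which in general varies with \<open>k\<close>, so all four factors stay in
      \<open>calD\<close>.\<close>
    define T where "T = t2 * g / (q * a * c^2)"
    have T: "T \<noteq> 0" using nonzero ne by (simp add: T_def)
    have "N - M = 1/t2 * dB k"
      using product_difference_factorization[OF T, of "y*q*a^2" "w*q*c^2" "u*q*c^2"]
      unfolding N_def M_def dB_def Q calD_def T_def
      using nonzero ne by (simp add: field_simps power2_eq_square)
    then show ?thesis
      unfolding B_Suc B_k by (metis mult.commute right_diff_distrib)
  qed

  \<comment> \<open>For \<open>n = 0\<close> the index is \<open>-1\<close>, and the quotient has to
    be matched with \<open>bd\<close>: the powers of the bases cancel between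
    \<open>num1 (-1)\<close> and \<open>den1 (-1)\<close>.\<close>
  have A_n: "A n = num1 (int n - 1) / den1 (int n - 1)"
  proof (cases n)
    case 0
    show ?thesis
      using 0
      by (simp add: A_def bd_def num1_def den1_def qpochs_def qpoch_minus_one mult.assoc)
  qed (simp add: A_def)
  have A_0: "A 0 = bd" by (simp add: A_def)
  have B_0: "B 0 = 1" by (simp add: B_def num2_def den2_def qpochs_def)

  have "C0 b d t1 * (\<Sum>k<n. dA k * (num1 (int k - 1) / den1 (int k)) * (num2 (int k) / den2 (int k)))
      = (\<Sum>k<n. (A (Suc k) - A k) * B k)"
    unfolding sum_distrib_left by (intro sum.cong refl) (simp add: step1 B_def)
  also have "\<dots> = A n * B n - A 0 * B 0 - (\<Sum>k<n. A (Suc k) * (B (Suc k) - B k))"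
    by (rule sum_by_parts)
  also have "(\<Sum>k<n. A (Suc k) * (B (Suc k) - B k))
      = 1/t2 * (\<Sum>k<n. dB k * (num2 (int k) / den2 (int k + 1)) * (num1 (int k) / den1 (int k)))"
    unfolding sum_distrib_left by (intro sum.cong refl) (simp add: step2 A_def mult_ac)
  finally show ?thesis
    unfolding A_n A_0 B_0 mult_1_right
    unfolding B_def dA_def dB_def num1_def den1_def num2_def den2_def bd_def .
qed

end
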